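(* Let $k$ be an integer with $0\le k\le 4$ and let $G$ be a finite $k$-regular graph, where multi-edges are allowed but loops are not ($G$ is not assumed connected). Then $G$ has a maximum matching $M$ such that any two distinct $M$-unsaturated vertices do not share a neighbor, i.e. there are no distinct $M$-unsaturated vertices $u,v$ and vertex $w$ of $G$ with $w$ adjacent to both $u$ and $v$.
   Context: Graphs may have multi-edges (several parallel edges between the same two vertices) but no loops. The degree of a vertex is the number of edges incident with it, counted with multiplicity; a graph is $k$-regular if every vertex has degree $k$. Two vertices are adjacent (neighbors) if at least one edge joins them. A matching of $G$ is a set of edges no two of which share an endvertex. A matching $M$ is maximum if $|M|\ge |M'|$ for every matching $M'$ of $G$. A vertex is $M$-saturated if it is incident with an edge of $M$, and $M$-unsaturated otherwise. *)

theory Defs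
  imports Main
begin

text \<open>Edges are abstract objects of type \<open>'e\<close>, and \<open>ends e\<close> is the set of the two endvertices of
  the edge \<open>e\<close>. Parallel edges are distinct edges with the same \<open>ends\<close>; loops are excluded because
  \<open>ends e\<close> has exactly two elements.\<close>

locale finite_multigraph =
  fixes V :: "'v set" and E :: "'e set" and ends :: "'e \<Rightarrow> 'v set"
  assumes finite_V: "finite V"
    and finite_E: "finite E"
    and ends_subset: "e \<in> E \<Longrightarrow> ends e \<subseteq> V"
    and card_ends: "e \<in> E \<Longrightarrow> card (ends e) = 2"

definition degree :: "'e set \<Rightarrow> ('e \<Rightarrow> 'v set) \<Rightarrow> 'v \<Rightarrow> nat" where
  "degree E ends v = card {e \<in> E. v \<in> ends e}"

definition regular :: "nat \<Rightarrow> 'v set \<Rightarrow> 'e set \<Rightarrow> ('e \<Rightarrow> 'v set) \<Rightarrow> bool" where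
  "regular k V E ends \<longleftrightarrow> (\<forall>v\<in>V. degree E ends v = k)"

definition adjacent :: "'e set \<Rightarrow> ('e \<Rightarrow> 'v set) \<Rightarrow> 'v \<Rightarrow> 'v \<Rightarrow> bool" where
  "adjacent E ends u v \<longleftrightarrow> (\<exists>e\<in>E. ends e = {u, v})"

definition matching :: "'e set \<Rightarrow> ('e \<Rightarrow> 'v set) \<Rightarrow> 'e set \<Rightarrow> bool" where
  "matching E ends M \<longleftrightarrow>
    M \<subseteq> E \<and> (\<forall>e\<in>M. \<forall>f\<in>M. e \<noteq> f \<longrightarrow> ends e \<inter> ends f = {})"

definition maximum_matching :: "'e set \<Rightarrow> ('e \<Rightarrow> 'v set) \<Rightarrow> 'e set \<Rightarrow> bool" where
  "maximum_matching E ends M \<longleftrightarrow>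
    matching E ends M \<and> (\<forall>M'. matching E ends M' \<longrightarrow> card M' \<le> card M)"

definition saturated :: "('e \<Rightarrow> 'v set) \<Rightarrow> 'e set \<Rightarrow> 'v \<Rightarrow> bool" where
  "saturated ends M v \<longleftrightarrow> (\<exists>e\<in>M. v \<in> ends e)"

end

theory Submission imports Defs begin

text \<open>
  Call a vertex inessential if some maximum matching misses it, and let \<open>I\<close> be the set of
  inessential vertices all of whose neighbours are inessential.  A maximum matching that misses only
  vertices of \<open>I\<close> is as required.  For suppose that it misses \<open>u\<close> and \<open>v\<close> and that \<open>w\<close> is adjacent to
  both.  Then \<open>w\<close> is inessential, and no maximum matching misses \<open>w\<close> together with \<open>u\<close> or with \<open>v\<close>,
  since the edge between them could be added.  But "no maximum matching misses both" is a transitive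
  relation on the inessential vertices (\<open>nu_parallel_trans\<close>), so no maximum matching misses both \<open>u\<close>
  and \<open>v\<close>.

  To reach \<open>I\<close>, take a maximum matching that misses as few vertices outside \<open>I\<close> as possible, and
  suppose that it misses \<open>u \<notin> I\<close>.  Fix the set \<open>U\<close> of its other missed vertices.  The graph \<open>G - U\<close> has
  deficiency one.  If \<open>X\<close> is the set of its inessential vertices, any \<open>x \<in> X\<close> can replace \<open>u\<close> as a
  missed vertex, so it is enough to find a vertex of \<open>X\<close> whose neighbours all lie in \<open>X\<close>
  (\<open>closed_neighbourhood_in_inessential\<close>); such a vertex lies in \<open>I\<close>, which contradicts minimality.

  This vertex comes from the Gallai-Edmonds structure of \<open>G - U\<close>.  Let \<open>Y\<close> be the set of neighbours
  of \<open>X\<close> outside \<open>X\<close>.  Deleting \<open>Y\<close> does not change the set of inessential vertices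
  (\<open>inessential_union\<close>) and raises the deficiency to \<open>card Y + 1\<close>.  Call two inessential vertices
  parallel if they are equal or no maximum matching misses both.  The parallel classes of the
  vertices missed by a maximum matching of \<open>G - U - Y\<close> are therefore \<open>card Y + 1\<close> disjoint sets; they
  are odd, and all edges leaving them end in \<open>Y\<close>.  At most \<open>k * card Y\<close> edges meet \<open>Y\<close>, so some class \<open>Q\<close> has fewer than
  \<open>k\<close> outgoing edges.  Parity then leaves at most \<open>k - 2 \<le> 2\<close> of them, whereas \<open>Q\<close> has at least three
  vertices, because a single vertex would have \<open>k\<close> outgoing edges.  Hence some vertex of \<open>Q\<close> has no
  neighbour outside \<open>Q\<close>; this is the only place where \<open>k \<le> 4\<close> is used.

  Both facts about inessential vertices follow from one exchange property of two matchings
  (\<open>matching_exchange\<close>), which plays the part of the usual alternating paths.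
\<close>

section \<open>Exchange between two matchings\<close>

context finite_multigraph begin

text \<open>A matching of \<open>G - S\<close>; the vertices of \<open>S\<close> are excluded by a condition on edges, so that the
  graph stays fixed while \<open>S\<close> varies.\<close>

definition avoiding_matching :: "'v set \<Rightarrow> 'e set \<Rightarrow> bool" where
  "avoiding_matching S M \<longleftrightarrow> matching E ends M \<and> (\<forall>e\<in>M. ends e \<inter> S = {})"

lemma avoiding_matching_mono:
  "avoiding_matching T M \<Longrightarrow> S \<subseteq> T \<Longrightarrow> avoiding_matching S M"
  unfolding avoiding_matching_def by blast

lemma avoiding_matching_finite: "avoiding_matching S M \<Longrightarrow> finite M"
  unfolding avoiding_matching_def matching_def using finite_E finite_subset by blast

lemma ends_nonempty: "e \<in> E \<Longrightarrow> ends e \<noteq> {}"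
  using card_ends by force

lemma ends_other:
  assumes "e \<in> E" "x \<in> ends e"
  obtains y where "ends e = {x, y}" "y \<noteq> x"
proof -
  obtain a b where ab: "ends e = {a, b}" "a \<noteq> b"
    using card_ends[OF assms(1)] by (meson card_2_iff)
  show thesis
  proof (cases "x = a")
    case True then show thesis using ab that[of b] by auto
  next
    case False then show thesis using ab assms(2) that[of a] by auto
  qed
qed

lemma avoiding_matching_insert:
  assumes "avoiding_matching (S \<union> ends e) M" "e \<in> E"
  shows "avoiding_matching (S - ends e) (insert e M)" "e \<notin> M"
  using assms ends_nonempty[OF assms(2)] unfolding avoiding_matching_def matching_def by blast+

lemma avoiding_matching_remove:
  assumes "avoiding_matching S M" "e \<in> M"
  shows "avoiding_matching (S \<union> ends e) (M - {e})"
  using assms unfolding avoiding_matching_def matching_def by blast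

text \<open>
  If \<open>M\<close> covers \<open>d\<close>, the component of the symmetric difference of \<open>M\<close> and \<open>N\<close> that contains \<open>d\<close> is a
  path starting at \<open>d\<close>, and swapping \<open>M\<close> and \<open>N\<close> along it changes only which of them covers the two
  end vertices.  The set \<open>R\<close> records the other end when it belongs to exactly one of \<open>S\<close> and \<open>T\<close>, and
  the sets to avoid become the symmetric differences of \<open>S\<close> and \<open>T\<close> with \<open>{d} \<union> R\<close>.  Instead of
  handling paths, the proof removes the first two edges of the path and continues from its third
  vertex.\<close>

lemma matching_exchange:
  assumes "avoiding_matching S M" "avoiding_matching T N" "d \<in> T" "d \<notin> S"
  shows "\<exists>M' N' R. card M' + card N' = card M + card N
    \<and> R \<subseteq> (S - T) \<union> (T - S) - {d} \<and> (R = {} \<or> (\<exists>v. R = {v}))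
    \<and> avoiding_matching ((S - R) \<union> (R - S) \<union> {d}) M'
    \<and> avoiding_matching ((T - R) \<union> (R - T) - {d}) N'"
  using assms
proof (induction "card M" arbitrary: M N S T d rule: less_induct)
  case less
  note M = less.prems(1) and N = less.prems(2)
  have finM: "finite M" "finite N"
    using M N avoiding_matching_finite by auto
  show ?case
  proof (cases "\<exists>e\<in>M. d \<in> ends e")
    case False
    have "avoiding_matching (S \<union> {d}) M"
      using M False unfolding avoiding_matching_def by blast
    moreover have "avoiding_matching (T - {d}) N"
      using N by (rule avoiding_matching_mono) auto
    ultimately show ?thesis
      by (intro exI[of _ M] exI[of _ N] exI[of _ "{}"]) auto
  next
    case True
    then obtain e where e: "e \<in> M" "d \<in> ends e" by blast
    have eE: "e \<in> E" using M e unfolding avoiding_matching_def matching_def by blast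
    obtain d1 where d1: "ends e = {d, d1}" "d1 \<noteq> d" using ends_other[OF eE e(2)] .
    have d1S: "d1 \<notin> S" using M e d1 unfolding avoiding_matching_def by blast
    have M0: "avoiding_matching (S \<union> {d, d1}) (M - {e})"
      using avoiding_matching_remove[OF M e(1)] d1 by simp
    have cM: "card M = Suc (card (M - {e}))"
      using card.remove[OF finM(1) e(1)] by simp
    show ?thesis
    proof (cases "\<exists>g\<in>N. d1 \<in> ends g")
      case False
      have "avoiding_matching (T \<union> ends e) N"
        using N False less.prems(3) unfolding avoiding_matching_def d1(1) by auto
      note ins = avoiding_matching_insert[OF this eE]
      have c: "card (M - {e}) + card (insert e N) = card M + card N"
        unfolding cM using ins(2) finM by simp
      \<comment> \<open>The path is the single edge \<open>e\<close>, with far end \<open>d1\<close>.\<close>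
      define R where "R = {d1} \<inter> T"
      have "avoiding_matching ((S - R) \<union> (R - S) \<union> {d}) (M - {e})"
        using M0 by (rule avoiding_matching_mono) (auto simp: R_def)
      moreover have "avoiding_matching ((T - R) \<union> (R - T) - {d}) (insert e N)"
        using ins(1) by (rule avoiding_matching_mono) (auto simp: R_def d1)
      moreover have "R \<subseteq> (S - T) \<union> (T - S) - {d} \<and> (R = {} \<or> (\<exists>v. R = {v}))"
        using d1S d1 unfolding R_def by auto
      ultimately show ?thesis using c
        by (intro exI[of _ "M - {e}"] exI[of _ "insert e N"] exI[of _ R]) blast
    next
      case True
      then obtain g where g: "g \<in> N" "d1 \<in> ends g" by blast
      have gE: "g \<in> E" using N g unfolding avoiding_matching_def matching_def by blast
      obtain d2 where d2: "ends g = {d1, d2}" "d2 \<noteq> d1" using ends_other[OF gE g(2)] .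
      have nT: "d1 \<notin> T" "d2 \<notin> T" using N g d2 unfolding avoiding_matching_def by blast+
      then have d2d: "d2 \<noteq> d" using less.prems(3) by blast
      have N0: "avoiding_matching (T \<union> {d1, d2}) (N - {g})"
        using avoiding_matching_remove[OF N g(1)] d2 by simp
      have cN: "card N = Suc (card (N - {g}))"
        using card.remove[OF finM(2) g(1)] by simp
      show ?thesis
      proof (cases "d2 \<in> S")
        case True
        \<comment> \<open>The path stops at \<open>d2\<close>, which \<open>M\<close> does not cover.\<close>
        have "avoiding_matching ((S - {d2} \<union> {d}) \<union> ends g) (M - {e})"
          using M0 by (rule avoiding_matching_mono) (use True d2 in auto)
        note insM = avoiding_matching_insert[OF this gE]
        have "avoiding_matching (insert d2 T \<union> ends e) (N - {g})"
          using N0 by (rule avoiding_matching_mono) (use less.prems(3) d1 in auto)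
        note insN = avoiding_matching_insert[OF this eE]
        have c: "card (insert g (M - {e})) + card (insert e (N - {g})) = card M + card N"
          using card_insert_disjoint[OF finite_Diff[OF finM(1)] insM(2)]
            card_insert_disjoint[OF finite_Diff[OF finM(2)] insN(2)] cM cN by linarith
        have a: "avoiding_matching ((S - {d2}) \<union> ({d2} - S) \<union> {d}) (insert g (M - {e}))"
          using insM(1) by (rule avoiding_matching_mono) (use True d2 d1 d1S d2d in auto)
        have b: "avoiding_matching ((T - {d2}) \<union> ({d2} - T) - {d}) (insert e (N - {g}))"
          using insN(1) by (rule avoiding_matching_mono) (use d2 d1 d2d nT in auto)
        have "{d2} \<subseteq> (S - T) \<union> (T - S) - {d}" using True nT d2d by blast
        with a b c show ?thesis
          by (intro exI[of _ "insert g (M - {e})"] exI[of _ "insert e (N - {g})"] exI[of _ "{d2}"]) simp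
      next
        case False
        \<comment> \<open>Apply the induction hypothesis at \<open>d2\<close>.  Both matchings must keep avoiding \<open>d\<close> and \<open>d1\<close>,
          so that \<open>g\<close> and \<open>e\<close> can be added with exchanged roles afterwards.\<close>
        have N0': "avoiding_matching (T \<union> {d, d1, d2}) (N - {g})"
          using N0 by (rule avoiding_matching_mono) (use less.prems(3) in auto)
        have "card (M - {e}) < card M" using cM by simp
        from less.hyps[OF this M0 N0', of d2] False d2 d2d
        obtain M1 N1 R where c1: "card M1 + card N1 = card (M - {e}) + card (N - {g})"
          and R: "R \<subseteq> (S \<union> {d, d1} - (T \<union> {d, d1, d2})) \<union> (T \<union> {d, d1, d2} - (S \<union> {d, d1})) - {d2}"
            "R = {} \<or> (\<exists>v. R = {v})"
          and M1: "avoiding_matching ((S \<union> {d, d1} - R) \<union> (R - (S \<union> {d, d1})) \<union> {d2}) M1"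
          and N1: "avoiding_matching ((T \<union> {d, d1, d2} - R) \<union> (R - (T \<union> {d, d1, d2})) - {d2}) N1"
          by auto
        have "avoiding_matching ((S - R) \<union> (R - S) \<union> {d} \<union> ends g) M1"
          using M1 by (rule avoiding_matching_mono) (use R d2 in auto)
        note insM = avoiding_matching_insert[OF this gE]
        have "avoiding_matching (((T - R) \<union> (R - T)) \<union> ends e) N1"
          using N1 by (rule avoiding_matching_mono) (use R d1 d2 d2d nT in auto)
        note insN = avoiding_matching_insert[OF this eE]
        have c: "card (insert g M1) + card (insert e N1) = card M + card N"
          unfolding cM cN using insM(2) insN(2) c1 M1[THEN avoiding_matching_finite]
            N1[THEN avoiding_matching_finite] by simp
        have a: "avoiding_matching ((S - R) \<union> (R - S) \<union> {d}) (insert g M1)"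
          using insM(1) by (rule avoiding_matching_mono) (use R d2 d1 d1S d2d False in auto)
        have b: "avoiding_matching ((T - R) \<union> (R - T) - {d}) (insert e N1)"
          using insN(1) by (rule avoiding_matching_mono) (use R d2 d1 d2d nT in auto)
        have "R \<subseteq> (S - T) \<union> (T - S) - {d}" using R(1) by blast
        with a b c R(2) show ?thesis
          by (intro exI[of _ "insert g M1"] exI[of _ "insert e N1"] exI[of _ R]) simp
      qed
    qed
  qed
qed

section \<open>The matching number after deleting vertices\<close>

text \<open>The matching number of \<open>G - S\<close>.\<close>

definition nu :: "'v set \<Rightarrow> nat" where
  "nu S = Max (card ` {M. avoiding_matching S M})"

lemma finite_avoiding: "finite {M. avoiding_matching S M}"
  by (rule finite_subset[of _ "Pow E"]) (use finite_E in \<open>auto simp: avoiding_matching_def matching_def\<close>)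

lemma nu_ge: "avoiding_matching S M \<Longrightarrow> card M \<le> nu S"
  unfolding nu_def using finite_avoiding by (intro Max_ge) auto

lemma nu_attained:
  obtains M where "avoiding_matching S M" "card M = nu S"
proof -
  have "avoiding_matching S {}" unfolding avoiding_matching_def matching_def by simp
  then have "nu S \<in> card ` {M. avoiding_matching S M}"
    unfolding nu_def using finite_avoiding by (intro Max_in) auto
  then show thesis using that by auto
qed

lemma nu_antimono: "S \<subseteq> T \<Longrightarrow> nu T \<le> nu S"
  by (metis nu_attained nu_ge avoiding_matching_mono)

lemma nu_insert_ge: "nu S \<le> Suc (nu (insert x S))"
proof -
  obtain M where M: "avoiding_matching S M" "card M = nu S" by (rule nu_attained)
  show ?thesis
  proof (cases "\<exists>e\<in>M. x \<in> ends e")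
    case False
    then have "avoiding_matching (insert x S) M" using M unfolding avoiding_matching_def by blast
    then show ?thesis using nu_ge M(2) by fastforce
  next
    case True
    then obtain e where e: "e \<in> M" "x \<in> ends e" by blast
    then have "avoiding_matching (insert x S) (M - {e})"
      using avoiding_matching_remove[OF M(1) e(1)] by (auto elim!: avoiding_matching_mono)
    then show ?thesis
      using nu_ge M(2) e(1) avoiding_matching_finite[OF M(1)] by (metis card_Suc_Diff1 Suc_le_mono)
  qed
qed

lemma nu_adjacent:
  assumes "adjacent E ends x y" "x \<notin> S" "y \<notin> S"
  shows "Suc (nu (S \<union> {x, y})) \<le> nu S"
proof -
  obtain e where e: "e \<in> E" "ends e = {x, y}" using assms(1) unfolding adjacent_def by blast
  obtain M where M: "avoiding_matching (S \<union> ends e) M" "card M = nu (S \<union> {x, y})"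
    using nu_attained e(2) by metis
  note ins = avoiding_matching_insert[OF M(1) e(1)]
  have "avoiding_matching S (insert e M)"
    using ins(1) by (rule avoiding_matching_mono) (use e assms in auto)
  from nu_ge[OF this] show ?thesis
    using ins(2) M avoiding_matching_finite by simp
qed

lemma nu_exchange:
  assumes "d \<in> T" "d \<notin> S"
  shows "\<exists>R \<subseteq> (S - T) \<union> (T - S) - {d}. (R = {} \<or> (\<exists>v. R = {v})) \<and>
    nu S + nu T \<le> nu ((S - R) \<union> (R - S) \<union> {d}) + nu ((T - R) \<union> (R - T) - {d})"
proof -
  obtain M N where M: "avoiding_matching S M" "card M = nu S"
    and N: "avoiding_matching T N" "card N = nu T"
    by (metis nu_attained)
  from matching_exchange[OF M(1) N(1) assms] obtain M' N' R where
    "card M' + card N' = card M + card N" "R \<subseteq> (S - T) \<union> (T - S) - {d}" "R = {} \<or> (\<exists>v. R = {v})"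
    "avoiding_matching ((S - R) \<union> (R - S) \<union> {d}) M'"
    "avoiding_matching ((T - R) \<union> (R - T) - {d}) N'" by blast
  then show ?thesis using nu_ge M(2) N(2) by (metis add_mono)
qed

text \<open>
  Transitivity of being parallel in \<open>G - S\<close>, in contrapositive form: if some maximum matching misses
  both \<open>x\<close> and \<open>y\<close>, then an inessential \<open>w\<close> cannot be parallel to both.  In a matching missing \<open>x\<close> and
  \<open>y\<close>, exchange with one missing \<open>w\<close>: the result misses \<open>w\<close> and loses at most one of \<open>x\<close> and \<open>y\<close>.  Nothing
  is lost in size, since the two exchanged matchings are at most maximum and together have the
  original sum.\<close>

lemma nu_parallel_trans:
  assumes "nu (insert w S) = nu S" "nu (S \<union> {x, y}) = nu S"
    and "x \<noteq> y" "w \<noteq> x" "w \<noteq> y" "w \<notin> S" "x \<notin> S" "y \<notin> S"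
  shows "nu (S \<union> {w, x}) = nu S \<or> nu (S \<union> {w, y}) = nu S"
proof -
  have le: "nu (S \<union> A) \<le> nu S" for A by (rule nu_antimono) auto
  have w: "w \<in> insert w S" "w \<notin> S \<union> {x, y}" using assms by auto
  have D: "(S \<union> {x, y} - insert w S) \<union> (insert w S - (S \<union> {x, y})) - {w} = {x, y}"
    using assms by blast
  obtain R where R: "R \<subseteq> {x, y}" "R = {} \<or> (\<exists>v. R = {v})"
    and "nu (S \<union> {x, y}) + nu (insert w S) \<le> nu ((S \<union> {x, y} - R) \<union> (R - (S \<union> {x, y})) \<union> {w})
        + nu ((insert w S - R) \<union> (R - insert w S) - {w})"
    using nu_exchange[OF w, unfolded D] by metis
  then have ineq: "nu S + nu S \<le> nu ((S \<union> {x, y} - R) \<union> (R - (S \<union> {x, y})) \<union> {w})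
        + nu ((insert w S - R) \<union> (R - insert w S) - {w})"
    using assms(1,2) by simp
  have "(insert w S - R) \<union> (R - insert w S) - {w} = S \<union> R" using R(1) assms by blast
  moreover have "(S \<union> {x, y} - R) \<union> (R - (S \<union> {x, y})) \<union> {w} = S \<union> (insert w ({x, y} - R))"
    using R(1) assms by blast
  ultimately have "nu S + nu S \<le> nu (S \<union> (insert w ({x, y} - R))) + nu (S \<union> R)"
    using ineq by simp
  then have full: "nu (S \<union> (insert w ({x, y} - R))) = nu S"
    using le[of R] le[of "insert w ({x, y} - R)"] by linarith
  have "x \<notin> R \<or> y \<notin> R" using R(2) assms(3) by auto
  then have "S \<union> {w, x} \<subseteq> S \<union> (insert w ({x, y} - R)) \<or> S \<union> {w, y} \<subseteq> S \<union> (insert w ({x, y} - R))"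
    by blast
  then show ?thesis using full nu_antimono le by (metis le_antisym)
qed

text \<open>
  Gallai's stability lemma: deleting a vertex \<open>y\<close> that every maximum matching covers, but that has
  an inessential neighbour \<open>x\<close>, creates no new inessential vertex \<open>d\<close>.  Otherwise exchange a matching
  missing \<open>x\<close> with one missing \<open>y\<close> and \<open>d\<close>, whose sizes sum to \<open>2 * nu S - 1\<close>.  Whatever the far end
  \<open>R\<close> of the exchange is, the resulting pair of sizes has a smaller sum: either both sizes are
  below \<open>nu S\<close>, or one of the matchings misses \<open>x\<close>, \<open>y\<close> and \<open>d\<close> and has size at most \<open>nu S - 2\<close>, since it could be enlarged by an edge
  between \<open>x\<close> and \<open>y\<close> and would still miss \<open>d\<close>.\<close>

lemma nu_stability:
  assumes "adjacent E ends x y" "x \<notin> S" "y \<notin> S" "d \<notin> S" "d \<noteq> y"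
    and x: "nu (insert x S) = nu S" and y: "nu (insert y S) \<noteq> nu S"
    and d: "nu (insert d (insert y S)) = nu (insert y S)"
  shows "nu (insert d S) = nu S"
proof (rule ccontr)
  assume nd: "nu (insert d S) \<noteq> nu S"
  have xd: "d \<noteq> x" using nd x by auto
  have xy: "x \<noteq> y" using x y by auto
  have y': "Suc (nu (insert y S)) = nu S"
    using y nu_insert_ge[of S y] nu_antimono[of S "insert y S"] by force
  have d': "Suc (nu (insert d S)) \<le> nu S"
    using nd nu_antimono[of S "insert d S"] by force
  have xyd: "Suc (Suc (nu (S \<union> {x, y, d}))) \<le> nu S"
    using nu_adjacent[OF assms(1), of "insert d S"] assms xd d' by (simp add: insert_commute)
  have dd: "d \<in> S \<union> {y, d}" "d \<notin> insert x S" using xd assms by auto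
  have D: "(insert x S - (S \<union> {y, d})) \<union> (S \<union> {y, d} - insert x S) - {d} = {x, y}"
    using assms xd xy by blast
  obtain R where R: "R \<subseteq> {x, y}" "R = {} \<or> (\<exists>v. R = {v})"
    and ineq: "nu (insert x S) + nu (S \<union> {y, d}) \<le> nu ((insert x S - R) \<union> (R - insert x S) \<union> {d})
        + nu ((S \<union> {y, d} - R) \<union> (R - (S \<union> {y, d})) - {d})"
    using nu_exchange[OF dd, unfolded D] by metis
  have L: "Suc (nu (insert x S) + nu (S \<union> {y, d})) = nu S + nu S"
    using x d y' by (simp add: insert_commute)
  consider "R = {}" | "R = {x}" | "R = {y}" using R xy by blast
  then show False
  proof cases
    case 1
    have "nu ((insert x S - R) \<union> (R - insert x S) \<union> {d}) \<le> nu (insert d S)"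
      using 1 by (intro nu_antimono) auto
    moreover have "nu ((S \<union> {y, d} - R) \<union> (R - (S \<union> {y, d})) - {d}) \<le> nu (insert y S)"
      using 1 assms by (intro nu_antimono) auto
    ultimately show False using ineq L d' y' by linarith
  next
    case 2
    have "nu ((insert x S - R) \<union> (R - insert x S) \<union> {d}) \<le> nu (insert d S)"
      using 2 assms by (intro nu_antimono) auto
    moreover have "nu ((S \<union> {y, d} - R) \<union> (R - (S \<union> {y, d})) - {d}) \<le> nu (insert y S)"
      using 2 assms xy by (intro nu_antimono) auto
    ultimately show False using ineq L d' y' by linarith
  next
    case 3
    have "nu ((insert x S - R) \<union> (R - insert x S) \<union> {d}) \<le> nu (S \<union> {x, y, d})"
      using 3 assms xy by (intro nu_antimono) auto
    moreover have "nu ((S \<union> {y, d} - R) \<union> (R - (S \<union> {y, d})) - {d}) \<le> nu S"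
      using 3 assms by (intro nu_antimono) auto
    ultimately show False using ineq L xyd by linarith
  qed
qed

section \<open>Inessential vertices\<close>

text \<open>The vertices of \<open>G - S\<close> missed by some maximum matching of \<open>G - S\<close>; this is the set called
  \<open>D\<close> in the Gallai-Edmonds decomposition.\<close>

definition inessential :: "'v set \<Rightarrow> 'v set" where
  "inessential S = {v \<in> V - S. nu (insert v S) = nu S}"

definition uncovered :: "'e set \<Rightarrow> 'v set" where
  "uncovered M = V - \<Union> (ends ` M)"

lemma adjacent_in_V: "adjacent E ends x y \<Longrightarrow> x \<in> V \<and> y \<in> V"
  using ends_subset unfolding adjacent_def by blast

lemma adjacent_neq: "adjacent E ends x y \<Longrightarrow> x \<noteq> y"
  using card_ends unfolding adjacent_def by force

lemma adjacent_sym: "adjacent E ends x y \<longleftrightarrow> adjacent E ends y x"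
  unfolding adjacent_def by (simp add: insert_commute)

lemma nu_eq_interval: "A \<subseteq> B \<Longrightarrow> B \<subseteq> C \<Longrightarrow> nu C = nu A \<Longrightarrow> nu B = nu A"
  using nu_antimono[of A B] nu_antimono[of B C] by simp

lemma inessential_insert:
  assumes "x \<in> inessential S" "adjacent E ends x y" "y \<notin> S" "y \<notin> inessential S"
  shows "inessential (insert y S) = inessential S" and "Suc (nu (insert y S)) = nu S"
proof -
  have ny: "nu (insert y S) \<noteq> nu S"
    using assms adjacent_in_V unfolding inessential_def by blast
  then show sy: "Suc (nu (insert y S)) = nu S"
    using nu_insert_ge[of S y] nu_antimono[of S "insert y S"] by force
  have "nu (insert d S) = nu S"
    if "d \<notin> S" "d \<noteq> y" "nu (insert d (insert y S)) = nu (insert y S)" for d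
    using nu_stability[OF assms(2) _ assms(3) that(1,2) _ ny that(3)] assms(1)
    unfolding inessential_def by blast
  moreover have "nu (insert d (insert y S)) = nu (insert y S)" if "nu (insert d S) = nu S" for d
    using that sy nu_insert_ge[of "insert d S" y] nu_antimono[of "insert y S" "insert d (insert y S)"]
    by (simp add: insert_commute subset_insertI)
  ultimately show "inessential (insert y S) = inessential S"
    using ny unfolding inessential_def by blast
qed

text \<open>Since a deletion leaves the set of inessential vertices unchanged, each remaining vertex of
  \<open>Z\<close> keeps its inessential neighbour, and the vertices of \<open>Z\<close> can be deleted one by one.\<close>

lemma inessential_union:
  assumes "finite Z" "Z \<inter> S = {}" "Z \<inter> inessential S = {}"
    and "\<forall>z\<in>Z. \<exists>x\<in>inessential S. adjacent E ends x z"
  shows "inessential (S \<union> Z) = inessential S \<and> nu (S \<union> Z) + card Z = nu S"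
  using assms
proof (induction Z rule: finite_induct)
  case empty
  then show ?case by simp
next
  case (insert z Z)
  then have IH: "inessential (S \<union> Z) = inessential S" "nu (S \<union> Z) + card Z = nu S" by auto
  obtain x where x: "x \<in> inessential (S \<union> Z)" "adjacent E ends x z"
    using insert.prems(3) IH(1) by auto
  have "z \<notin> S \<union> Z" "z \<notin> inessential (S \<union> Z)"
    using insert.prems insert.hyps IH(1) by auto
  from inessential_insert[OF x this] show ?case
    using IH insert.hyps by simp
qed

section \<open>Counting vertices and edges\<close>

lemma card_covered:
  assumes "matching E ends M"
  shows "card (\<Union> (ends ` M)) = 2 * card M"
proof -
  have M: "M \<subseteq> E" "finite M"
    using assms finite_E finite_subset unfolding matching_def by auto
  have "card (\<Union> (ends ` M)) = (\<Sum>e\<in>M. card (ends e))"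
  proof (rule card_UN_disjoint)
    show "\<forall>e\<in>M. finite (ends e)"
      using M(1) ends_subset finite_V finite_subset by (meson subsetD)
  qed (use assms M in \<open>auto simp: matching_def\<close>)
  also have "\<dots> = (\<Sum>e\<in>M. 2)"
    using M(1) card_ends by (intro sum.cong) auto
  finally show ?thesis by simp
qed

lemma card_uncovered:
  assumes "matching E ends M"
  shows "card V = card (uncovered M) + 2 * card M"
proof -
  have "\<Union> (ends ` M) \<subseteq> V"
    using assms ends_subset unfolding matching_def by blast
  then show ?thesis
    using card_covered[OF assms] finite_V card_mono[of V "\<Union> (ends ` M)"]
    unfolding uncovered_def by (simp add: card_Diff_subset finite_subset)
qed

definition boundary :: "'v set \<Rightarrow> 'e set" where
  "boundary Q = {e \<in> E. ends e \<inter> Q \<noteq> {} \<and> \<not> ends e \<subseteq> Q}"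

text \<open>The handshake lemma for a vertex subset.\<close>

lemma degree_sum:
  assumes "finite Q"
  shows "(\<Sum>v\<in>Q. degree E ends v) = 2 * card {e \<in> E. ends e \<subseteq> Q} + card (boundary Q)"
proof -
  have c: "card (ends e \<inter> Q) = (if ends e \<subseteq> Q then 2 else 0) + (if e \<in> boundary Q then 1 else 0)"
    if e: "e \<in> E" for e
  proof -
    obtain a b where ab: "ends e = {a, b}" "a \<noteq> b"
      using card_ends[OF e] by (meson card_2_iff)
    then show ?thesis using e unfolding boundary_def
      by (cases "a \<in> Q"; cases "b \<in> Q") auto
  qed
  have "(\<Sum>v\<in>Q. degree E ends v) = (\<Sum>v\<in>Q. \<Sum>e\<in>E. if v \<in> ends e then 1 else 0)"
    unfolding degree_def using finite_E by (simp add: sum.If_cases Int_def)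
  also have "\<dots> = (\<Sum>e\<in>E. \<Sum>v\<in>Q. if v \<in> ends e then 1 else 0)"
    by (rule sum.swap)
  also have "\<dots> = (\<Sum>e\<in>E. card (ends e \<inter> Q))"
    using assms by (intro sum.cong) (auto simp: sum.If_cases Int_def conj_commute)
  also have "\<dots> = (\<Sum>e\<in>E. (if ends e \<subseteq> Q then 2 else 0) + (if e \<in> boundary Q then 1 else 0))"
    using c by (intro sum.cong) auto
  also have "\<dots> = 2 * card {e \<in> E. ends e \<subseteq> Q} + card (E \<inter> boundary Q)"
    using finite_E by (simp add: sum.distrib sum.If_cases Int_def)
  also have "E \<inter> boundary Q = boundary Q"
    unfolding boundary_def by blast
  finally show ?thesis .
qed

text \<open>
  If every vertex of \<open>Q\<close> were on a boundary edge, then \<open>card Q \<le> card (boundary Q) < k\<close>, because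
  a boundary edge has only one end in \<open>Q\<close>.  By the handshake lemma the boundary has the parity of
  \<open>k * card Q\<close>, hence of \<open>k\<close>, so \<open>card (boundary Q) \<le> k - 2 \<le> 2\<close> and \<open>Q\<close> is a single
  vertex.  All \<open>k\<close> edges at that vertex are boundary edges, as there are no loops.\<close>

lemma interior_vertex:
  assumes "regular k V E ends" "k \<le> 4" "Q \<subseteq> V" "odd (card Q)" "card (boundary Q) < k"
  shows "\<exists>x\<in>Q. \<forall>e\<in>boundary Q. x \<notin> ends e"
proof (rule ccontr)
  assume "\<not> ?thesis"
  then obtain g where g: "\<And>x. x \<in> Q \<Longrightarrow> g x \<in> boundary Q \<and> x \<in> ends (g x)"
    by metis
  have finQ: "finite Q" using assms(3) finite_V finite_subset by blast
  have finb: "finite (boundary Q)" using finite_E unfolding boundary_def by simp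
  have "inj_on g Q"
  proof (rule inj_onI, rule ccontr)
    fix x y assume xy: "x \<in> Q" "y \<in> Q" "g x = g y" "x \<noteq> y"
    have E: "g x \<in> E" "\<not> ends (g x) \<subseteq> Q" using g[OF xy(1)] unfolding boundary_def by auto
    obtain z where "ends (g x) = {x, z}" using ends_other[OF E(1)] g[OF xy(1)] by metis
    then show False using g[OF xy(2)] xy E(2) by auto
  qed
  then have le: "card Q \<le> card (boundary Q)"
    using g finb by (intro card_inj_on_le[of g]) auto
  have deg: "k * card Q = 2 * card {e \<in> E. ends e \<subseteq> Q} + card (boundary Q)"
    using degree_sum[OF finQ] assms(1,3) unfolding regular_def
    by (simp add: subset_iff mult.commute)
  have "card Q \<noteq> 1"
  proof
    assume 1: "card Q = 1"
    have none: "{e \<in> E. ends e \<subseteq> Q} = {}"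
    proof (rule ccontr)
      assume "{e \<in> E. ends e \<subseteq> Q} \<noteq> {}"
      then obtain e where "e \<in> E" "ends e \<subseteq> Q" by blast
      then show False using card_mono[OF finQ, of "ends e"] card_ends 1 by simp
    qed
    show False using deg assms(5) 1 unfolding none by simp
  qed
  then have "card Q \<ge> 3" using assms(4) by (cases "card Q = 2") (auto elim: oddE)
  then have "k = 4" "card (boundary Q) = 3" using le assms(2,5) by auto
  then show False using deg by presburger
qed

section \<open>Parallel classes in a graph of deficiency one\<close>

text \<open>
  The cardinality hypothesis says that \<open>G - U\<close> has deficiency one.  The sets \<open>Q u\<close> below are the
  parallel classes of the vertices \<open>u\<close> missed by a maximum matching \<open>M\<close> of \<open>G - S\<close>, where \<open>S = U \<union> Y\<close>.
  Adjacent inessential vertices are parallel, so these classes are unions of components of \<open>X\<close> and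
  take the place of the factor-critical components without any appeal to connectedness.\<close>

lemma closed_neighbourhood_in_inessential:
  assumes "regular k V E ends" "0 < k" "k \<le> 4"
    and "U \<subseteq> V" "nu U = nu {}" "card V = Suc (card U + 2 * nu {})"
  shows "\<exists>x\<in>inessential U. \<forall>w. adjacent E ends x w \<longrightarrow> w \<in> inessential U"
proof -
  define X where "X = inessential U"
  define Y where "Y = {y \<in> V. y \<notin> X \<and> (\<exists>x\<in>X. adjacent E ends x y)}"
  define S where "S = U \<union> Y"
  have finY: "finite Y" unfolding Y_def using finite_V by simp
  have finU: "finite U" using assms(4) finite_V finite_subset by blast
  \<comment> \<open>An edge from \<open>x \<in> X\<close> to \<open>U\<close> could be added to a matching of size \<open>nu {}\<close> that misses both ends.\<close>
  have YU: "Y \<inter> U = {}"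
  proof (rule ccontr)
    assume "Y \<inter> U \<noteq> {}"
    then obtain x y where y: "y \<in> U" "x \<in> X" "adjacent E ends x y" unfolding Y_def by blast
    have "nu (insert x U) = nu {}" using y(2) assms(5) unfolding X_def inessential_def by simp
    then have "nu {x, y} = nu {}"
      using y by (intro nu_eq_interval[of "{}" "{x, y}" "insert x U"]) auto
    then show False using nu_adjacent[OF y(3), of "{}"] by simp
  qed
  have "inessential S = inessential U \<and> nu S + card Y = nu U"
    unfolding S_def using finY YU by (intro inessential_union) (auto simp: Y_def X_def)
  then have XS: "inessential S = X" and nuS: "nu S + card Y = nu {}"
    using assms(5) unfolding X_def by auto
  have XV: "X \<subseteq> V" "X \<inter> S = {}" and X_nu: "\<And>d. d \<in> X \<Longrightarrow> nu (insert d S) = nu S"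
    unfolding XS[symmetric] inessential_def by auto
  have nbr: "w \<in> X \<union> Y" if "x \<in> X" "adjacent E ends x w" for x w
    using that adjacent_in_V unfolding Y_def by blast
  obtain M where M: "avoiding_matching S M" "card M = nu S" by (rule nu_attained)
  have mM: "matching E ends M" using M(1) unfolding avoiding_matching_def by simp
  define W where "W = uncovered M - S"
  \<comment> \<open>Deleting \<open>Y\<close> removes \<open>card Y\<close> vertices, but also \<open>card Y\<close> edges from a maximum matching, so the
    deficiency grows from \<open>1\<close> to \<open>1 + card Y\<close>.\<close>
  have cW: "card W = Suc (card Y)"
  proof -
    have "S \<subseteq> uncovered M"
      using M(1) assms(4) unfolding avoiding_matching_def uncovered_def S_def Y_def by blast
    then have "card (uncovered M) = card W + card S"
      using finU finY unfolding W_def S_def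
      by (metis card_Diff_subset card_mono finite_Diff finite_Un finite_V le_add_diff_inverse2 uncovered_def)
    moreover have "card S = card U + card Y"
      unfolding S_def using YU finU finY by (simp add: card_Un_disjoint Int_commute)
    ultimately show ?thesis using card_uncovered[OF mM] M(2) assms(6) nuS by linarith
  qed
  have WX: "W \<subseteq> X"
  proof
    fix u assume u: "u \<in> W"
    then have "avoiding_matching (insert u S) M"
      using M(1) unfolding avoiding_matching_def W_def uncovered_def by blast
    then have "nu (insert u S) = nu S"
      using nu_ge M(2) nu_antimono[of S "insert u S"] by (metis le_antisym subset_insertI)
    then show "u \<in> X" using u unfolding XS[symmetric] inessential_def W_def uncovered_def by blast
  qed
  have Wpair: "nu (S \<union> {u, v}) = nu S" if "u \<in> W" "v \<in> W" for u v
  proof -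
    have "avoiding_matching (S \<union> {u, v}) M"
      using M(1) that unfolding avoiding_matching_def W_def uncovered_def by blast
    then show ?thesis
      using nu_ge M(2) nu_antimono[of S "S \<union> {u, v}"] by (metis Un_upper1 le_antisym)
  qed
  define Q where "Q u = {d \<in> X. d = u \<or> nu (S \<union> {d, u}) \<noteq> nu S}" for u
  \<comment> \<open>A common element would be parallel to both \<open>u\<close> and \<open>v\<close>, although \<open>M\<close> misses both.\<close>
  have disj: "Q u \<inter> Q v = {}" if uv: "u \<in> W" "v \<in> W" "u \<noteq> v" for u v
  proof (rule ccontr)
    assume "Q u \<inter> Q v \<noteq> {}"
    then obtain d where d: "d \<in> Q u" "d \<in> Q v" by blast
    have p: "nu (S \<union> {u, v}) = nu S" "nu (S \<union> {v, u}) = nu S" using Wpair uv by auto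
    have ne: "d \<noteq> u" "d \<noteq> v" using d p uv(3) unfolding Q_def by auto
    have dS: "d \<notin> S" "u \<notin> S" "v \<notin> S" "nu (insert d S) = nu S"
      using d XV X_nu WX uv unfolding Q_def by auto
    have "nu (S \<union> {d, u}) = nu S \<or> nu (S \<union> {d, v}) = nu S"
      using nu_parallel_trans[OF dS(4) p(1) uv(3) ne dS(1-3)] .
    then show False using d ne unfolding Q_def by blast
  qed
  have closed: "d' \<in> Q u" if u: "u \<in> W" and d: "d \<in> Q u" "adjacent E ends d d'" "d' \<in> X" for u d d'
  proof (rule ccontr)
    assume n: "d' \<notin> Q u"
    then have n': "d' \<noteq> u" "nu (S \<union> {d', u}) = nu S" using d(3) unfolding Q_def by auto
    have dS: "d \<notin> S" "d' \<notin> S" "u \<notin> S" "nu (insert d S) = nu S"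
      using d XV X_nu WX u unfolding Q_def by auto
    have dd: "nu (S \<union> {d, d'}) \<noteq> nu S" using nu_adjacent[OF d(2) dS(1,2)] by simp
    then have du: "d \<noteq> u" using n' by (auto simp: insert_commute)
    from nu_parallel_trans[OF dS(4) n'(2) n'(1) adjacent_neq[OF d(2)] du dS(1-3)]
    show False using dd du d(1) unfolding Q_def by blast
  qed
  have bd: "ends e \<inter> Y \<noteq> {} \<and> ends e - Y \<subseteq> Q u" if u: "u \<in> W" and e: "e \<in> boundary (Q u)" for u e
  proof -
    obtain d where d: "d \<in> ends e" "d \<in> Q u" "e \<in> E" using e unfolding boundary_def by blast
    obtain d' where d': "ends e = {d, d'}" using ends_other[OF d(3,1)] .
    have "d' \<notin> Q u" using e d d' unfolding boundary_def by auto
    moreover have a: "adjacent E ends d d'" using d d' unfolding adjacent_def by blast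
    ultimately have "d' \<in> Y" using closed[OF u d(2) a] nbr[OF _ a] d(2) unfolding Q_def by blast
    then show ?thesis using d d' by auto
  qed
  \<comment> \<open>\<open>M\<close> uses no vertex of \<open>Y\<close>, so it matches \<open>Q u - {u}\<close> within itself.\<close>
  have odd: "odd (card (Q u))" if u: "u \<in> W" for u
  proof -
    define F where "F = {e \<in> M. ends e \<inter> Q u \<noteq> {}}"
    have uQ: "u \<in> Q u" using u WX unfolding Q_def by auto
    have "Q u - {u} = \<Union> (ends ` F)"
    proof (intro equalityI subsetI)
      fix d assume d: "d \<in> Q u - {u}"
      have "d \<notin> W"
      proof
        assume "d \<in> W"
        then have "d \<in> Q d" using WX unfolding Q_def by blast
        then show False using disj[OF u \<open>d \<in> W\<close>] d by blast
      qed
      moreover have "d \<in> V - S" using d XV unfolding Q_def by blast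
      ultimately show "d \<in> \<Union> (ends ` F)" using d unfolding W_def uncovered_def F_def by blast
    next
      fix z assume "z \<in> \<Union> (ends ` F)"
      then obtain e d where e: "e \<in> M" "z \<in> ends e" "d \<in> ends e" "d \<in> Q u" unfolding F_def by blast
      have eE: "e \<in> E" "ends e \<inter> S = {}"
        using e(1) M(1) unfolding avoiding_matching_def matching_def by blast+
      then have "e \<notin> boundary (Q u)" using bd[OF u] unfolding S_def by blast
      then have "z \<in> Q u" using e eE unfolding boundary_def by blast
      moreover have "z \<noteq> u" using u e unfolding W_def uncovered_def by blast
      ultimately show "z \<in> Q u - {u}" by blast
    qed
    moreover have "matching E ends F" using mM unfolding F_def matching_def by blast
    ultimately have c: "card (Q u - {u}) = 2 * card F" using card_covered by metis
    have "Q u \<subseteq> V" using XV(1) unfolding Q_def by blast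
    then have "finite (Q u)" by (rule finite_subset[OF _ finite_V])
    from card.remove[OF this uQ] have "card (Q u) = Suc (2 * card F)" unfolding c .
    then show ?thesis by simp
  qed
  \<comment> \<open>Otherwise at least \<open>k * (card Y + 1)\<close> edges meet \<open>Y\<close>, more than the degrees in \<open>Y\<close> allow.\<close>
  have "\<exists>u\<in>W. card (boundary (Q u)) < k"
  proof (rule ccontr)
    assume "\<not> ?thesis"
    then have ge: "\<And>u. u \<in> W \<Longrightarrow> k \<le> card (boundary (Q u))" by force
    have finW: "finite W" using cW card.infinite by fastforce
    have finb: "finite (boundary A)" for A unfolding boundary_def using finite_E by simp
    have "k * Suc (card Y) \<le> (\<Sum>u\<in>W. card (boundary (Q u)))"
      using sum_mono[of W "\<lambda>_. k" "\<lambda>u. card (boundary (Q u))"] ge cW by (simp add: mult.commute)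
    also have "\<dots> = card (\<Union>u\<in>W. boundary (Q u))"
    proof (rule card_UN_disjoint[symmetric, OF finW])
      show "\<forall>u\<in>W. \<forall>v\<in>W. u \<noteq> v \<longrightarrow> boundary (Q u) \<inter> boundary (Q v) = {}"
      proof (intro ballI impI, rule ccontr)
        fix u v assume uv: "u \<in> W" "v \<in> W" "u \<noteq> v" "boundary (Q u) \<inter> boundary (Q v) \<noteq> {}"
        then obtain e where e: "e \<in> boundary (Q u)" "e \<in> boundary (Q v)" by blast
        then obtain d where d: "d \<in> ends e" "d \<in> Q u" unfolding boundary_def by blast
        then have "d \<notin> Y" unfolding Q_def Y_def by blast
        then have "d \<in> Q v" using bd[OF uv(2) e(2)] d by blast
        then show False using disj[OF uv(1-3)] d by blast
      qed
    qed (use finb in auto)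
    also have "\<dots> \<le> card (\<Union>y\<in>Y. {e \<in> E. y \<in> ends e})"
    proof (rule card_mono)
      show "finite (\<Union>y\<in>Y. {e \<in> E. y \<in> ends e})" using finY finite_E by simp
      show "(\<Union>u\<in>W. boundary (Q u)) \<subseteq> (\<Union>y\<in>Y. {e \<in> E. y \<in> ends e})"
        using bd unfolding boundary_def by blast
    qed
    also have "\<dots> \<le> (\<Sum>y\<in>Y. card {e \<in> E. y \<in> ends e})"
      by (rule card_UN_le[OF finY])
    also have "\<dots> = (\<Sum>y\<in>Y. k)"
      using assms(1) unfolding regular_def degree_def Y_def by (intro sum.cong) auto
    finally show False using assms(2) by simp
  qed
  then obtain u where u: "u \<in> W" "card (boundary (Q u)) < k" by blast
  have "Q u \<subseteq> V" using XV(1) unfolding Q_def by blast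
  from interior_vertex[OF assms(1,3) this odd[OF u(1)] u(2)]
  obtain x where x: "x \<in> Q u" "\<forall>e\<in>boundary (Q u). x \<notin> ends e" by blast
  have "w \<in> X" if "adjacent E ends x w" for w
    using that x unfolding adjacent_def boundary_def Q_def by blast
  moreover have "x \<in> X" using x(1) unfolding Q_def by blast
  ultimately show ?thesis unfolding X_def by blast
qed

section \<open>Maximum matchings whose missed vertices have no common neighbour\<close>

lemma maximum_matching_iff: "maximum_matching E ends M \<longleftrightarrow> matching E ends M \<and> card M = nu {}"
proof -
  have a: "avoiding_matching {} N \<longleftrightarrow> matching E ends N" for N
    unfolding avoiding_matching_def by simp
  show ?thesis
    unfolding maximum_matching_def using nu_ge[of "{}"] nu_attained[of "{}"]
    by (metis a le_antisym)
qed

text \<open>An inessential \<open>w\<close> is parallel to each of its neighbours \<open>u\<close> and \<open>v\<close>, so \<open>u\<close> and \<open>v\<close> are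
  parallel and cannot both be missed.\<close>

lemma no_common_neighbour:
  assumes "u \<noteq> v" "nu {u, v} = nu {}" "w \<in> inessential {}"
    and "adjacent E ends w u" "adjacent E ends w v"
  shows False
proof -
  have "nu {w} = nu {}" using assms(3) unfolding inessential_def by simp
  then have "nu {w, u} = nu {} \<or> nu {w, v} = nu {}"
    using nu_parallel_trans[of w "{}" u v] assms(1,2) adjacent_neq[OF assms(4)]
      adjacent_neq[OF assms(5)] by simp
  then show False
    using nu_adjacent[OF assms(4), of "{}"] nu_adjacent[OF assms(5), of "{}"] by auto
qed

end

theorem theorem1p3:
  fixes k :: nat and V :: "'v set" and E :: "'e set" and ends :: "'e \<Rightarrow> 'v set"
  assumes "finite_multigraph V E ends"
    and "k \<le> 4"
    and "regular k V E ends"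
  shows "\<exists>M. maximum_matching E ends M \<and>
    \<not> (\<exists>u\<in>V. \<exists>v\<in>V. \<exists>w\<in>V. u \<noteq> v \<and> \<not> saturated ends M u \<and> \<not> saturated ends M v \<and>
        adjacent E ends w u \<and> adjacent E ends w v)"
proof -
  interpret finite_multigraph V E ends by (rule assms(1))
  have unsat: "\<not> saturated ends M v \<longleftrightarrow> v \<in> uncovered M" if "v \<in> V" for M v
    using that unfolding saturated_def uncovered_def by blast
  show ?thesis
  proof (cases "k = 0")
    case True
    \<comment> \<open>Here the edge count behind the main argument is void, but there are no edges at all.\<close>
    have "\<not> adjacent E ends w u" for w u
    proof
      assume a: "adjacent E ends w u"
      then have "degree E ends w = 0"
        using True assms(3) adjacent_in_V unfolding regular_def by blast
      then show False using a finite_E unfolding degree_def adjacent_def by auto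
    qed
    moreover have "\<exists>M. maximum_matching E ends M"
      using nu_attained[of "{}"] maximum_matching_iff unfolding avoiding_matching_def by metis
    ultimately show ?thesis by blast
  next
    case False
    define I where "I = {v \<in> inessential {}. \<forall>w. adjacent E ends v w \<longrightarrow> w \<in> inessential {}}"
    let ?P = "\<lambda>M. matching E ends M \<and> card M = nu {}"
    have "\<exists>M. ?P M"
      using nu_attained[of "{}"] unfolding avoiding_matching_def by metis
    then obtain M where M: "?P M"
      and least: "\<And>N. ?P N \<Longrightarrow> card (uncovered M - I) \<le> card (uncovered N - I)"
      using ex_has_least_nat[of ?P _ "\<lambda>M. card (uncovered M - I)"] by blast
    have fin: "finite (uncovered N)" for N unfolding uncovered_def using finite_V by simp
    have nuM: "nu A = nu {}" if "A \<subseteq> uncovered M" for A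
    proof -
      have "avoiding_matching A M" using M that unfolding avoiding_matching_def uncovered_def by blast
      then show ?thesis using nu_ge M nu_antimono[of "{}" A] by (metis empty_subsetI le_antisym)
    qed
    \<comment> \<open>A missed vertex \<open>u\<close> outside \<open>I\<close> can be traded for a vertex \<open>x\<close> of \<open>I\<close>.\<close>
    have UI: "uncovered M \<subseteq> I"
    proof (rule ccontr)
      assume "\<not> uncovered M \<subseteq> I"
      then obtain u where u: "u \<in> uncovered M" "u \<notin> I" by blast
      define U where "U = uncovered M - {u}"
      have cU: "card (uncovered M) = Suc (card U)"
        using card.remove[OF fin u(1)] unfolding U_def by simp
      have U: "U \<subseteq> V" "nu U = nu {}" "card V = Suc (card U + 2 * nu {})"
        using nuM[of U] cU card_uncovered[of M] M unfolding U_def uncovered_def by auto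
      obtain x where x: "x \<in> inessential U" "\<And>w. adjacent E ends x w \<Longrightarrow> w \<in> inessential U"
        using closed_neighbourhood_in_inessential[OF assms(3) _ assms(2) U] False by blast
      have "inessential U \<subseteq> inessential {}"
      proof
        fix v assume "v \<in> inessential U"
        then have v: "v \<in> V" "nu (insert v U) = nu {}" using U(2) unfolding inessential_def by auto
        then have "nu {v} = nu {}" by (intro nu_eq_interval[of "{}" "{v}" "insert v U"]) auto
        then show "v \<in> inessential {}" using v(1) unfolding inessential_def by simp
      qed
      then have xI: "x \<in> I" using x unfolding I_def by blast
      have xU: "x \<in> V" "x \<notin> U" "nu (insert x U) = nu {}"
        using x(1) U(2) unfolding inessential_def by auto
      obtain N where N: "avoiding_matching (insert x U) N" "card N = nu {}"
        using nu_attained[of "insert x U"] xU(3) by metis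
      then have PN: "?P N" unfolding avoiding_matching_def by simp
      have sub: "insert x U \<subseteq> uncovered N"
        using N(1) U(1) xU(1) unfolding avoiding_matching_def uncovered_def by blast
      have "card (uncovered N) = card (uncovered M)"
        using card_uncovered[of M] card_uncovered[of N] M PN by simp
      also have "\<dots> = card (insert x U)"
        using cU xU(2) fin unfolding U_def by simp
      finally have "uncovered N = insert x U"
        using card_subset_eq[OF fin sub] by simp
      then have "uncovered N - I \<subset> uncovered M - I"
        using xI u unfolding U_def by (intro psubsetI) auto
      then have "card (uncovered N - I) < card (uncovered M - I)"
        using fin by (intro psubset_card_mono) auto
      then show False using least[OF PN] by simp
    qed
    have False if "u \<in> V" "v \<in> V" "u \<noteq> v" "\<not> saturated ends M u" "\<not> saturated ends M v"
      "adjacent E ends w u" "adjacent E ends w v" for u v w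
    proof (rule no_common_neighbour[OF that(3) _ _ that(6,7)])
      have uv: "u \<in> uncovered M" "v \<in> uncovered M" using that unsat by auto
      then show "nu {u, v} = nu {}" by (intro nuM) simp
      have "u \<in> I" using uv UI by blast
      then show "w \<in> inessential {}" using that(6) adjacent_sym unfolding I_def by blast
    qed
    then show ?thesis using M maximum_matching_iff by blast
  qed
qed

end
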